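(* Let $a \geq 2$ be an integer. Then the only functions $f \in \mathscr{C}^0(\mathbb{R},\mathbb{R})$ which are solutions of the functional equation $(E_{0,a})$, i.e. which satisfy $$f(a x) = \frac{1}{a} \sum_{k=0}^{a-1} f\left(x + \frac{k}{a}\right) \qquad (\forall x \in \mathbb{R}),$$ are the constant functions.
   Context: $\mathscr{C}^0(\mathbb{R},\mathbb{R})$ denotes the set of continuous functions from $\mathbb{R}$ to $\mathbb{R}$. *)

theory Defs
  imports Complex_Main
begin

end

theory Submission
  imports Defs
begin

text \<open>
  Substituting \<open>x = y / a\<close> turns the functional equation into an averaging property:
  \<open>f y\<close> is the mean of the values of \<open>f\<close> at the \<open>a\<close> points \<open>(y + k) / a\<close>, \<open>0 \<le> k < a\<close>. The maps
  \<open>y \<mapsto> (y + k) / a\<close> are contractions which send every interval \<open>[-M, M]\<close> with \<open>M \<ge> 1\<close> into itself.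
  On such an interval a maximum principle holds: where \<open>f\<close> attains its maximum over \<open>[-M, M]\<close>, all
  the averaged values must be maximal too. Following the single branch \<open>y \<mapsto> y / a\<close>, the maximum is
  attained along a sequence tending to \<open>0\<close>, hence at \<open>0\<close> by continuity. Thus \<open>f \<le> f 0\<close>
  everywhere (\<open>solution_le_value_at_zero\<close>). The equation is linear, so \<open>-f\<close> obeys the same
  bound, and \<open>f\<close> is constant.
\<close>

text \<open>
  The averages below run over bounded values and equal their bound, so no term can fall short of it.
\<close>

lemma mean_eq_upper_bound_imp_eq:
  fixes g :: "'b \<Rightarrow> real"
  assumes "finite A" "j \<in> A" "\<And>k. k \<in> A \<Longrightarrow> g k \<le> m"
    and mean: "sum g A = real (card A) * m"
  shows "g j = m"
proof (rule ccontr)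
  assume "g j \<noteq> m"
  with assms have "g j < m" by fastforce
  with assms have "sum g A < (\<Sum>k\<in>A. m)"
    by (intro sum_strict_mono_ex1) auto
  with mean show False by simp
qed

text \<open>
  The extremes of \<open>(y + k) / a\<close> over \<open>\<bar>y\<bar> \<le> M\<close> and \<open>k < a\<close> are \<open>-M / a\<close> and \<open>(M + a - 1) / a\<close>; the latter is
  at most \<open>M\<close> exactly when \<open>M \<ge> 1\<close>, which is where that condition comes from.
\<close>

lemma inverse_branch_maps_interval_into_itself:
  fixes y M :: real and a k :: nat
  assumes "a \<ge> 2" "M \<ge> 1" "y \<in> {-M..M}" "k < a"
  shows "(y + real k) / real a \<in> {-M..M}"
proof -
  have "real k \<le> real a - 1" using \<open>k < a\<close> by linarith
  moreover have "0 \<le> (real a - 1) * (M - 1)"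
    using assms by (intro mult_nonneg_nonneg) auto
  moreover have "0 \<le> (real a - 1) * M"
    using assms by (intro mult_nonneg_nonneg) auto
  ultimately have "y + real k \<le> M * real a" "- M * real a \<le> y + real k"
    using assms by (auto simp: algebra_simps)
  then show ?thesis
    using assms by (simp add: field_simps)
qed

lemma solution_le_value_at_zero:
  fixes f :: "real \<Rightarrow> real" and a :: nat
  assumes a: "a \<ge> 2"
    and cont: "continuous_on UNIV f"
    and eq: "\<And>x. f (real a * x) = 1 / real a * (\<Sum>k = 0..a - 1. f (x + real k / real a))"
  shows "f x \<le> f 0"
proof -
  define M where "M = max 1 \<bar>x\<bar>"
  have M: "M \<ge> 1" "x \<in> {-M..M}" by (auto simp: M_def)
  have "continuous_on {-M..M} f" using cont continuous_on_subset by blast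
  then obtain y where y: "y \<in> {-M..M}" and max: "\<And>t. t \<in> {-M..M} \<Longrightarrow> f t \<le> f y"
    using continuous_attains_sup[of "{-M..M}" f] M by auto
  have branch: "f (t / real a) = f y \<and> t / real a \<in> {-M..M}"
    if t: "t \<in> {-M..M}" "f t = f y" for t
  proof -
    have in_int: "t / real a + real k / real a \<in> {-M..M}" if "k \<le> a - 1" for k
      using inverse_branch_maps_interval_into_itself[OF a M(1) t(1), of k] that a
      by (simp add: add_divide_distrib)
    have "(\<Sum>k\<in>{0..a - 1}. f (t / real a + real k / real a)) = real (card {0..a - 1}) * f y"
      using eq[of "t / real a"] t(2) a by (simp add: field_simps)
    then have "f (t / real a + real 0 / real a) = f y"
      using in_int max
      by (intro mean_eq_upper_bound_imp_eq[where A = "{0..a - 1}" and j = 0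
            and g = "\<lambda>k. f (t / real a + real k / real a)"]) auto
    then show ?thesis using in_int[of 0] by simp
  qed
  have iterate: "f (y / real a ^ n) = f y \<and> y / real a ^ n \<in> {-M..M}" for n
  proof (induction n)
    case 0
    then show ?case using y by simp
  next
    case (Suc n)
    then show ?case using branch[of "y / real a ^ n"] by (simp add: mult.commute)
  qed
  have "(\<lambda>n. y / real a ^ n) \<longlonglongrightarrow> 0"
    using a by (intro LIMSEQ_divide_realpow_zero) auto
  moreover have "isCont f 0" using cont by (simp add: continuous_on_eq_continuous_at)
  ultimately have "(\<lambda>n. f (y / real a ^ n)) \<longlonglongrightarrow> f 0"
    by (rule isCont_tendsto_compose[rotated])
  then have "f y = f 0" using iterate by (simp add: LIMSEQ_const_iff)
  with max[OF M(2)] show ?thesis by simp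
qed

theorem theorem3p3:
  fixes a :: nat
  assumes "a \<ge> 2"
  shows "{f :: real \<Rightarrow> real. continuous_on UNIV f \<and>
            (\<forall>x. f (real a * x) = 1 / real a * (\<Sum>k = 0..a - 1. f (x + real k / real a)))}
         = {f. \<exists>c. \<forall>x. f x = c}"
proof (intro equalityI subsetI; clarify)
  fix f :: "real \<Rightarrow> real"
  assume cont: "continuous_on UNIV f"
    and eq: "\<forall>x. f (real a * x) = 1 / real a * (\<Sum>k = 0..a - 1. f (x + real k / real a))"
  have "f x = f 0" for x
  proof (rule antisym)
    show "f x \<le> f 0"
      using solution_le_value_at_zero[OF assms cont] eq by blast
    have "- f x \<le> - f 0"
    proof (rule solution_le_value_at_zero[OF assms, of "\<lambda>x. - f x"])
      show "continuous_on UNIV (\<lambda>x. - f x)" using cont by (rule continuous_on_minus)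
    qed (use eq in \<open>simp add: sum_negf\<close>)
    then show "f 0 \<le> f x" by simp
  qed
  then show "\<exists>c. \<forall>x. f x = c" by blast
next
  fix f :: "real \<Rightarrow> real" and c
  assume "\<forall>x. f x = c"
  then have "f = (\<lambda>_. c)" by auto
  then show "continuous_on UNIV f \<and>
      (\<forall>x. f (real a * x) = 1 / real a * (\<Sum>k = 0..a - 1. f (x + real k / real a)))"
    using assms by simp
qed

end
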